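(* For every $n=1,2,\ldots$, $i=0,1,\ldots$, every rational polyhedron $P\subseteq\mathbb R^n$ and all regular triangulations $\Delta$ and $\Delta'$ of $P$, one has $\lambda(n,i,P,\Delta)=\lambda(n,i,P,\Delta')$.
   Context: A rational polyhedron in $\mathbb R^n$ is a union of finitely many (closed) simplexes in $\mathbb R^n$ whose vertices are in $\mathbb Q^n$. For a rational point $x=(x_1,\ldots,x_n)\in\mathbb Q^n$, $\operatorname{den}(x)$ is the least common denominator (a positive integer) of its coordinates, and $\tilde x=\operatorname{den}(x)(x_1,\ldots,x_n,1)\in\mathbb Z^{n+1}$ is its homogeneous correspondent. A simplex is rational if all its vertices are rational. A rational $m$-simplex $\operatorname{conv}(v_0,\ldots,v_m)\subseteq\mathbb R^n$ is regular if $\{\tilde v_0,\ldots,\tilde v_m\}$ is part of a basis of the free abelian group $\mathbb Z^{n+1}$. A simplicial complex is a finite set of simplexes in $\mathbb R^n$, closed under taking faces, any two of which intersect in a common face. A regular triangulation of $P$ is a simplicial complex $\Delta$ all of whose simplexes are rational and regular, and whose union is $P$. $\Delta^{\max}(i)$ denotes the set of $i$-dimensional simplexes of $\Delta$ that are maximal (with respect to inclusion) in $\Delta$. For a regular simplex $T=\operatorname{conv}(v_0,\ldots,v_m)$ put $\operatorname{den}(T)=\prod_{j=0}^m\operatorname{den}(v_j)$. Define $$\lambda(n,i,P,\Delta)=\sum_{T\in\Delta^{\max}(i)}\frac{1}{i!\,\operatorname{den}(T)},$$ with $\lambda(n,i,P,\Delta)=0$ if $\Delta^{\max}(i)=\emptyset$.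 *)

theory Defs
  imports "HOL-Analysis.Analysis"
begin

definition rational_point :: "real ^ 'n \<Rightarrow> bool" where
  "rational_point x \<longleftrightarrow> (\<forall>k. x $ k \<in> \<rat>)"

definition den :: "real ^ 'n \<Rightarrow> nat" where
  "den x = (LEAST d. d > 0 \<and> (\<forall>k. of_nat d * x $ k \<in> \<int>))"

(* Z^(n+1) is int ^ 'n option: the indices Some k are the n coordinates of x and None is the
   additional last one. The floor only turns a real number that is already an integer (for
   rational x) into an element of int; see of_int_homog below. *)
definition homog :: "real ^ 'n \<Rightarrow> int ^ 'n option" where
  "homog x = (\<chi> j. case j of Some k \<Rightarrow> \<lfloor>real (den x) * x $ k\<rfloor> | None \<Rightarrow> int (den x))"

interpretation int_lattice: module "(*s) :: int \<Rightarrow> int ^ 'm \<Rightarrow> int ^ 'm"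
  by unfold_locales (simp_all add: vec_eq_iff algebra_simps)

definition part_of_int_basis :: "(int ^ 'm) set \<Rightarrow> bool" where
  "part_of_int_basis A \<longleftrightarrow>
     (\<exists>B. A \<subseteq> B \<and> int_lattice.independent B \<and> int_lattice.span B = UNIV)"

definition vertices :: "(real ^ 'n) set \<Rightarrow> (real ^ 'n) set" where
  "vertices T = {v. v extreme_point_of T}"

definition rational_simplex :: "(real ^ 'n) set \<Rightarrow> bool" where
  "rational_simplex T \<longleftrightarrow> (\<exists>m. m simplex T) \<and> (\<forall>v \<in> vertices T. rational_point v)"

definition rational_polyhedron :: "(real ^ 'n) set \<Rightarrow> bool" where
  "rational_polyhedron P \<longleftrightarrow> (\<exists>F. finite F \<and> (\<forall>T \<in> F. rational_simplex T) \<and> P = \<Union>F)"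

definition regular_simplex :: "(real ^ 'n) set \<Rightarrow> bool" where
  "regular_simplex T \<longleftrightarrow> rational_simplex T \<and> part_of_int_basis (homog ` vertices T)"

(* A nonempty simplicial_complex contains the empty face, a (-1)-simplex. It is vacuously
   regular and is never an i-simplex for i :: nat, so it does not contribute to lambda_sum. *)
definition regular_triangulation :: "(real ^ 'n) set set \<Rightarrow> (real ^ 'n) set \<Rightarrow> bool" where
  "regular_triangulation \<Delta> P \<longleftrightarrow>
     simplicial_complex \<Delta> \<and> (\<forall>T \<in> \<Delta>. regular_simplex T) \<and> \<Union>\<Delta> = P"

definition max_simplexes :: "(real ^ 'n) set set \<Rightarrow> nat \<Rightarrow> (real ^ 'n) set set" where
  "max_simplexes \<Delta> i = {T \<in> \<Delta>. int i simplex T \<and> (\<forall>S \<in> \<Delta>. T \<subseteq> S \<longrightarrow> S = T)}"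

definition den_simplex :: "(real ^ 'n) set \<Rightarrow> nat" where
  "den_simplex T = (\<Prod>v \<in> vertices T. den v)"

(* lambda(n,i,P,Delta): n is carried by the type and P is the union of Delta, so neither
   is an argument. *)
definition lambda_sum :: "nat \<Rightarrow> (real ^ 'n) set set \<Rightarrow> real" where
  "lambda_sum i \<Delta> = (\<Sum>T \<in> max_simplexes \<Delta> i. 1 / (fact i * real (den_simplex T)))"

lemma den_rational_point:
  fixes x :: "real ^ 'n"
  assumes "rational_point x"
  shows "den x > 0" and "real (den x) * x $ k \<in> \<int>"
proof -
  have "\<exists>d::nat. d > 0 \<and> real d * x $ k \<in> \<int>" for k
  proof -
    obtain a b :: int where "b > 0" "x $ k = of_int a / of_int b"
      using assms unfolding rational_point_def by (meson Rats_cases')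
    then show ?thesis by (intro exI[of _ "nat b"]) auto
  qed
  then obtain d where d: "\<And>k. d k > (0::nat)" "\<And>k. real (d k) * x $ k \<in> \<int>" by metis
  have "real (\<Prod>j\<in>UNIV. d j) * x $ k \<in> \<int>" for k
  proof -
    have "real (\<Prod>j\<in>UNIV. d j) * x $ k = real (\<Prod>j\<in>UNIV-{k}. d j) * (real (d k) * x $ k)"
      by (subst prod.remove[of UNIV k]) auto
    also have "\<dots> \<in> \<int>" by (rule Ints_mult[OF Ints_of_nat d(2)])
    finally show ?thesis .
  qed
  moreover have "(\<Prod>j\<in>UNIV. d j) > 0" using d(1) by (intro prod_pos) auto
  ultimately have "\<exists>e. e > 0 \<and> (\<forall>k. real e * x $ k \<in> \<int>)" by blast
  from LeastI_ex[OF this] show "den x > 0" and "real (den x) * x $ k \<in> \<int>"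
    by (auto simp: den_def)
qed

lemma of_int_homog:
  assumes "rational_point x"
  shows "real_of_int (homog x $ Some k) = real (den x) * x $ k"
    and "homog x $ None = int (den x)"
  using den_rational_point(2)[OF assms] by (auto simp: homog_def)

lemma vertices_convex_hull:
  "\<not> affine_dependent C \<Longrightarrow> vertices (convex hull C) = C"
  by (simp add: vertices_def extreme_point_of_convex_hull_affine_independent)

end

theory Submission
  imports Defs
begin

text \<open>The number of integer points at height at most \<open>N\<close> in the cone over a set \<open>S\<close> placed at
  height \<open>1\<close> is monotone and subadditive in \<open>S\<close>, and does not refer to any triangulation. For a
  regular \<open>i\<close>-simplex \<open>T\<close> these points are exactly the combinations of the homogeneous vertices
  with natural coefficients, so their number is asymptotically \<open>N ^ (i + 1) / ((i + 1)! * den T)\<close>;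
  simplexes of smaller dimension contribute \<open>o(N ^ (i + 1))\<close>. Near a relative interior point of a
  maximal \<open>i\<close>-simplex the polyhedron coincides with that simplex, so a second triangulation
  covers such a point by a maximal \<open>i\<close>-simplex or by a simplex of smaller dimension. Counting
  integer points gives both inequalities.\<close>

section \<open>Natural vectors of bounded weight\<close>

text \<open>Coefficient vectors on \<open>V\<close> are total functions set to zero off
  \<open>V\<close>, so that each vector is represented exactly once and can be counted.\<close>

definition bounded_weight :: "('a \<Rightarrow> nat) \<Rightarrow> 'a set \<Rightarrow> nat \<Rightarrow> ('a \<Rightarrow> nat) set" where
  "bounded_weight d V N = {a. (\<forall>x. x \<notin> V \<longrightarrow> a x = 0) \<and> (\<Sum>x\<in>V. a x * d x) \<le> N}"

lemma bounded_weight_empty: "bounded_weight d {} N = {\<lambda>_. 0}"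
  by (auto simp: bounded_weight_def)

text \<open>Either the coefficient at \<open>v\<close> is zero, or lowering it by one frees the
  weight \<open>d v\<close>. The guard \<open>d v \<le> N\<close> is essential: truncated
  subtraction would otherwise admit vectors that are too heavy.\<close>

lemma bounded_weight_insert:
  assumes "finite V" "v \<notin> V"
  shows "bounded_weight d (insert v V) N = bounded_weight d V N \<union>
    (if d v \<le> N then (\<lambda>a. a(v := Suc (a v))) ` bounded_weight d (insert v V) (N - d v) else {})"
    (is "?L = ?A \<union> ?B")
proof -
  have upd: "(\<Sum>x\<in>V. (a(v := k)) x * d x) = (\<Sum>x\<in>V. a x * d x)" for a k
    using assms(2) by (intro sum.cong) auto
  have "a \<in> ?A \<union> ?B" if a: "a \<in> ?L" for a
  proof (cases "a v")
    case 0
    then have "a \<in> ?A" using a assms by (simp add: bounded_weight_def) metis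
    then show ?thesis by blast
  next
    case (Suc k)
    have w: "Suc k * d v + (\<Sum>x\<in>V. a x * d x) \<le> N"
      using a assms Suc by (simp add: bounded_weight_def)
    then have "d v \<le> N" by simp
    moreover have "a(v := k) \<in> bounded_weight d (insert v V) (N - d v)"
      using a assms w upd[of a k] by (auto simp: bounded_weight_def)
    moreover have "a = (a(v := k))(v := Suc ((a(v := k)) v))"
      using Suc by (auto simp: fun_eq_iff)
    ultimately show ?thesis by (metis (mono_tags, lifting) UnCI imageI)
  qed
  moreover have "a \<in> ?L" if "a \<in> ?A" for a
    using that assms by (auto simp: bounded_weight_def)
  moreover have "a \<in> ?L" if a: "a \<in> ?B" for a
  proof -
    from a obtain b where b: "d v \<le> N" "b \<in> bounded_weight d (insert v V) (N - d v)"
      "a = b(v := Suc (b v))" by (auto split: if_splits)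
    then show ?thesis using assms upd[of b "Suc (b v)"] by (auto simp: bounded_weight_def)
  qed
  ultimately show ?thesis by blast
qed

lemma finite_bounded_weight:
  assumes "finite V" "\<And>v. v \<in> V \<Longrightarrow> d v > 0"
  shows "finite (bounded_weight d V N)"
  using assms
proof (induction V arbitrary: N rule: finite_induct)
  case empty
  then show ?case by (simp add: bounded_weight_empty)
next
  case (insert v V)
  show ?case
  \<comment> \<open>Positivity of \<open>d v\<close> makes \<open>N - d v\<close> smaller than
    \<open>N\<close>, so the recursion terminates.\<close>
  proof (induction N rule: less_induct)
    case (less N)
    have "finite (bounded_weight d (insert v V) (N - d v))" if "d v \<le> N"
      using less[of "N - d v"] that insert.prems[of v] by simp
    then show ?case
      using insert by (subst bounded_weight_insert) auto
  qed
qed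

text \<open>The two parts of the decomposition are disjoint, since only the second has a nonzero
  coefficient at \<open>v\<close>, and raising that coefficient is injective.\<close>

lemma card_bounded_weight_insert:
  assumes "finite V" "v \<notin> V" "\<And>x. x \<in> insert v V \<Longrightarrow> d x > 0"
  shows "card (bounded_weight d (insert v V) N) = card (bounded_weight d V N) +
    (if d v \<le> N then card (bounded_weight d (insert v V) (N - d v)) else 0)"
proof (cases "d v \<le> N")
  case True
  let ?f = "\<lambda>a::'a \<Rightarrow> nat. a(v := Suc (a v))"
  have "inj ?f"
    by (rule inj_on_inverseI[where g = "\<lambda>a. a(v := a v - 1)"]) auto
  then have "card (?f ` bounded_weight d (insert v V) (N - d v))
      = card (bounded_weight d (insert v V) (N - d v))"
    by (intro card_image) (auto intro: inj_on_subset)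
  moreover have "bounded_weight d V N \<inter> ?f ` bounded_weight d (insert v V) (N - d v) = {}"
    using assms(2) by (auto simp: bounded_weight_def)
  moreover have "finite (bounded_weight d V N)" "finite (bounded_weight d (insert v V) (N - d v))"
    using assms by (auto intro!: finite_bounded_weight)
  ultimately show ?thesis
    using True unfolding bounded_weight_insert[OF assms(1,2), of d N]
    by (simp add: card_Un_disjoint)
next
  case False
  then show ?thesis using assms by (subst bounded_weight_insert) auto
qed

section \<open>Polynomial bounds for the number of vectors\<close>

text \<open>The difference factors as \<open>x - y\<close> times a sum of \<open>Suc m\<close>
  monomials of degree \<open>m\<close>, each between \<open>y ^ m\<close> and
  \<open>x ^ m\<close>.\<close>

lemma power_Suc_diff_bounds:
  fixes x y :: real
  assumes "0 \<le> y" "y \<le> x"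
  shows "x ^ Suc m - y ^ Suc m \<le> real (Suc m) * (x - y) * x ^ m"
    and "real (Suc m) * (x - y) * y ^ m \<le> x ^ Suc m - y ^ Suc m"
proof -
  have eq: "x ^ Suc m - y ^ Suc m = (x - y) * (\<Sum>p<Suc m. x ^ p * y ^ (m - p))"
    by (rule diff_power_eq_sum)
  have "x ^ p * y ^ (m - p) \<le> x ^ m" if "p < Suc m" for p
    using that mult_left_mono[OF power_mono[of y x "m - p"], of "x ^ p"] assms
    by (simp add: power_add[symmetric])
  then have "(\<Sum>p<Suc m. x ^ p * y ^ (m - p)) \<le> real (Suc m) * x ^ m"
    using sum_bounded_above[of "{..<Suc m}" "\<lambda>p. x ^ p * y ^ (m - p)" "x ^ m"] by simp
  from mult_left_mono[OF this, of "x - y"] assms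
  show "x ^ Suc m - y ^ Suc m \<le> real (Suc m) * (x - y) * x ^ m"
    unfolding eq by (simp only: mult_ac)
  have "y ^ m \<le> x ^ p * y ^ (m - p)" if "p < Suc m" for p
    using that mult_right_mono[OF power_mono[of y x p], of "y ^ (m - p)"] assms
    by (simp add: power_add[symmetric])
  then have "real (Suc m) * y ^ m \<le> (\<Sum>p<Suc m. x ^ p * y ^ (m - p))"
    using sum_bounded_below[of "{..<Suc m}" "y ^ m" "\<lambda>p. x ^ p * y ^ (m - p)"] by simp
  from mult_left_mono[OF this, of "x - y"] assms
  show "real (Suc m) * (x - y) * y ^ m \<le> x ^ Suc m - y ^ Suc m"
    unfolding eq by (simp only: mult_ac)
qed

text \<open>The outer terms are the volumes of the real simplexes of nonnegative vectors of weight
  at most \<open>N\<close> and at most \<open>N\<close> plus the sum of all \<open>d v\<close>. The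
  recursion for the count replaces any measure theory.\<close>

lemma card_bounded_weight_bounds:
  assumes "finite V" "\<And>v. v \<in> V \<Longrightarrow> d v > 0"
  shows "real N ^ card V / (fact (card V) * real (\<Prod>v\<in>V. d v)) \<le> real (card (bounded_weight d V N))
    \<and> real (card (bounded_weight d V N))
      \<le> (real N + real (\<Sum>v\<in>V. d v)) ^ card V / (fact (card V) * real (\<Prod>v\<in>V. d v))"
  using assms
proof (induction V arbitrary: N rule: finite_induct)
  case empty
  then show ?case by (simp add: bounded_weight_empty)
next
  case (insert v V)
  define m where "m = card V"
  define D where "D = real (\<Prod>v\<in>V. d v)"
  define s where "s = real (\<Sum>v\<in>V. d v)"
  define e where "e = real (d v)"
  have pos: "D > 0" "e > 0" "s \<ge> 0"
    using insert.prems by (auto simp: D_def e_def s_def intro!: prod_pos sum_nonneg)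
  \<comment> \<open>The denominator for \<open>insert v V\<close>. By \<open>scale\<close>, the
    bounds for \<open>V\<close> are put over it too, leaving inequalities between
    numerators.\<close>
  define E where "E = fact (Suc m) * (e * D)"
  have E: "E > 0" using pos by (simp add: E_def)
  have "E = (real (Suc m) * e) * (fact m * D)" by (simp add: E_def mult_ac)
  then have scale: "x / (fact m * D) = real (Suc m) * e * x / E" for x
    using pos by (simp del: of_nat_Suc)
  have IH: "real N ^ m / (fact m * D) \<le> real (card (bounded_weight d V N))"
    "real (card (bounded_weight d V N)) \<le> (real N + s) ^ m / (fact m * D)" for N
    using insert.IH[of N] insert.prems by (auto simp: m_def D_def s_def)
  have rec: "real (card (bounded_weight d (insert v V) N)) = real (card (bounded_weight d V N)) +
      (if d v \<le> N then real (card (bounded_weight d (insert v V) (N - d v))) else 0)" for N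
    using card_bounded_weight_insert[OF insert.hyps(1,2), of d N] insert.prems by simp
  have "real N ^ Suc m / E \<le> real (card (bounded_weight d (insert v V) N))
    \<and> real (card (bounded_weight d (insert v V) N)) \<le> (real N + (e + s)) ^ Suc m / E" for N
  proof (induction N rule: less_induct)
    case (less N)
    let ?n = "real N"
    \<comment> \<open>Enlarging the shift from \<open>s\<close> to \<open>e + s\<close> pays for the
      upper bound of the vectors that vanish at \<open>v\<close>.\<close>
    have up: "real (Suc m) * e * (?n + s) ^ m \<le> (?n + (e + s)) ^ Suc m - (?n + s) ^ Suc m"
      using power_Suc_diff_bounds(2)[of "?n + s" "?n + (e + s)" m] pos by (simp add: algebra_simps)
    show ?case
    proof (cases "d v \<le> N")
      case True
      have r: "real (N - d v) = ?n - e" using True by (simp add: e_def of_nat_diff)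
      have "N - d v < N" using True insert.prems[of v] by simp
      from less[OF this]
      have ih: "(?n - e) ^ Suc m / E \<le> real (card (bounded_weight d (insert v V) (N - d v)))"
        "real (card (bounded_weight d (insert v V) (N - d v))) \<le> (?n + s) ^ Suc m / E"
        unfolding r by (simp_all add: algebra_simps)
      have lo: "?n ^ Suc m - (?n - e) ^ Suc m \<le> real (Suc m) * e * ?n ^ m"
        using power_Suc_diff_bounds(1)[of "?n - e" ?n m] pos True by (simp add: e_def)
      have "?n ^ Suc m / E \<le> real (Suc m) * e * ?n ^ m / E + (?n - e) ^ Suc m / E"
        unfolding add_divide_distrib[symmetric] using lo E by (intro divide_right_mono) auto
      moreover have "real (Suc m) * e * (?n + s) ^ m / E + (?n + s) ^ Suc m / E
          \<le> (?n + (e + s)) ^ Suc m / E"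
        unfolding add_divide_distrib[symmetric] using up E by (intro divide_right_mono) auto
      ultimately show ?thesis
        using IH[of N] ih rec[of N] True unfolding scale by (simp del: of_nat_Suc power_Suc)
    next
      \<comment> \<open>The recursive summand is absent. Since \<open>?n \<le> e\<close>, the
        vectors vanishing at \<open>v\<close> already suffice for the lower bound.\<close>
      case False
      then have "?n \<le> e" by (simp add: e_def)
      then have "?n * ?n ^ m \<le> real (Suc m) * e * ?n ^ m"
        using pos by (intro mult_right_mono) (auto simp: algebra_simps add_increasing2)
      then have "?n ^ Suc m / E \<le> real (Suc m) * e * ?n ^ m / E"
        using E by (intro divide_right_mono) auto
      moreover have "real (Suc m) * e * (?n + s) ^ m \<le> (?n + (e + s)) ^ Suc m"
        using up pos by (smt (verit) zero_le_power of_nat_0_le_iff)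
      then have "real (Suc m) * e * (?n + s) ^ m / E \<le> (?n + (e + s)) ^ Suc m / E"
        using E by (intro divide_right_mono) auto
      ultimately show ?thesis
        using IH[of N] rec[of N] False unfolding scale by (simp del: of_nat_Suc power_Suc)
    qed
  qed
  moreover have "fact (card (insert v V)) * real (\<Prod>v\<in>insert v V. d v) = E"
    "card (insert v V) = Suc m" "real (\<Sum>v\<in>insert v V. d v) = e + s"
    using insert.hyps by (simp_all add: E_def m_def e_def D_def s_def)
  ultimately show ?case by (simp only:)
qed

section \<open>Integer points of the cone over a set\<close>

text \<open>Height is the coordinate \<open>None\<close>, and dividing by it projects back to height
  1. Height 0 is excluded: division by zero yields zero, so every vector of height 0 would count
  whenever the origin lies in \<open>S\<close>.\<close>

definition cone_points :: "nat \<Rightarrow> (real ^ 'n) set \<Rightarrow> (int ^ 'n option) set" where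
  "cone_points N S = {z. 0 < z $ None \<and> z $ None \<le> int N \<and>
     (\<chi> k. real_of_int (z $ Some k) / real_of_int (z $ None)) \<in> S}"

lemma cone_points_mono: "S \<subseteq> T \<Longrightarrow> cone_points N S \<subseteq> cone_points N T"
  by (auto simp: cone_points_def)

lemma cone_points_Un: "cone_points N (S \<union> T) = cone_points N S \<union> cone_points N T"
  by (auto simp: cone_points_def)

lemma cone_points_UN: "cone_points N (\<Union>i\<in>I. F i) = (\<Union>i\<in>I. cone_points N (F i))"
  by (auto simp: cone_points_def)

lemma cone_points_Int: "cone_points N (S \<inter> T) = cone_points N S \<inter> cone_points N T"
  by (auto simp: cone_points_def)

lemma cone_points_empty [simp]: "cone_points N {} = {}"
  by (auto simp: cone_points_def)

section \<open>Coordinates with respect to homogeneous vertices\<close>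

text \<open>The last coordinate recovers \<open>den x\<close>, and the others then recover
  \<open>x\<close>. This is needed because \<open>part_of_int_basis\<close> speaks of the image set
  under \<open>homog\<close>, not of a family indexed by vertices.\<close>

lemma inj_on_homog: "inj_on homog {x. rational_point x}"
proof (rule inj_onI)
  fix x y :: "real ^ 'n"
  assume xy: "x \<in> {x. rational_point x}" "y \<in> {x. rational_point x}" "homog x = homog y"
  then have d: "den x = den y" using of_int_homog(2) by (metis mem_Collect_eq of_nat_eq_iff)
  have "real (den x) * x $ k = real (den x) * y $ k" for k
    using xy of_int_homog(1) d by (metis mem_Collect_eq)
  then show "x = y" using den_rational_point(1)[of x] xy by (simp add: vec_eq_iff)
qed

text \<open>An integral dual functional also reads off real coordinates, so the real coefficients of an
  integer point in the cone over a regular simplex are integers.\<close>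
lemma part_of_int_basis_dual:
  fixes A :: "(int ^ 'm) set"
  assumes "part_of_int_basis A" "w \<in> A"
  obtains c :: "int ^ 'm" where "\<And>u. u \<in> A \<Longrightarrow> (\<Sum>j\<in>UNIV. c $ j * u $ j) = (if u = w then 1 else 0)"
proof -
  obtain B where B: "A \<subseteq> B" "int_lattice.independent B" "int_lattice.span B = UNIV"
    using assms(1) by (auto simp: part_of_int_basis_def)
  let ?\<phi> = "\<lambda>u. int_lattice.representation B u w"
  \<comment> \<open>The coefficient of \<open>w\<close> in the basis \<open>B\<close> is an additive
    integral functional, hence determined by its values on the unit vectors.\<close>
  define c :: "int ^ 'm" where "c = (\<chi> j. ?\<phi> (axis j 1))"
  show ?thesis
  proof (rule that[of c])
    fix u assume u: "u \<in> A"
    have "?\<phi> u = ?\<phi> (\<Sum>j\<in>UNIV. u $ j *s axis j 1)" by (simp add: basis_expansion)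
    also have "\<dots> = (\<Sum>j\<in>UNIV. c $ j * u $ j)"
      by (simp add: int_lattice.representation_sum int_lattice.representation_scale B c_def mult.commute)
    finally show "(\<Sum>j\<in>UNIV. c $ j * u $ j) = (if u = w then 1 else 0)"
      using int_lattice.representation_basis[OF B(2), of u] B(1) u by auto
  qed
qed

text \<open>Barycentric coordinates, rescaled, express a cone point through the homogeneous
  vertices, and regularity makes these coefficients integers. Height matches weight because
  \<open>homog v\<close> has height \<open>den v\<close>; the zero vector would give the excluded
  apex.\<close>

lemma bij_betw_cone_points:
  fixes V :: "(real ^ 'n) set"
  assumes "finite V" and rat: "\<And>v. v \<in> V \<Longrightarrow> rational_point v"
    and basis: "part_of_int_basis (homog ` V)"
  shows "bij_betw (\<lambda>a. \<Sum>v\<in>V. int (a v) *s homog v)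
    (bounded_weight den V N - {\<lambda>_. 0}) (cone_points N (convex hull V))"
proof -
  let ?h = "\<lambda>a. \<Sum>v\<in>V. int (a v) *s homog v"
  have nth: "?h a $ j = (\<Sum>v\<in>V. int (a v) * homog v $ j)" for a j
    by simp
  have den_pos: "den v > 0" if "v \<in> V" for v
    using den_rational_point(1) rat that by blast
  have dual: "\<exists>c. \<forall>v\<in>V. (\<Sum>j\<in>UNIV. c $ j * homog v $ j) = (if v = w then 1 else 0)"
    if w: "w \<in> V" for w
  proof -
    obtain c where c: "\<And>u. u \<in> homog ` V \<Longrightarrow> (\<Sum>j\<in>UNIV. c $ j * u $ j) = (if u = homog w then 1 else 0)"
      using part_of_int_basis_dual[OF basis imageI[OF w]] by metis
    have eq: "homog v = homog w \<longleftrightarrow> v = w" if "v \<in> V" for v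
      using inj_on_eq_iff[OF inj_on_homog, of v w] that w rat by simp
    show ?thesis
    proof (intro exI ballI)
      fix v assume v: "v \<in> V"
      show "(\<Sum>j\<in>UNIV. c $ j * homog v $ j) = (if v = w then 1 else 0)"
        unfolding c[OF imageI[OF v]] eq[OF v] ..
    qed
  qed
  \<comment> \<open>One integral functional recovers the coefficient at \<open>w\<close> from every
    real representation of an integer vector. This gives uniqueness of the coefficients for
    \<open>inj\<close> and their integrality for \<open>onto\<close>.\<close>
  have coord: "\<exists>c :: int ^ 'n option. \<forall>r z.
      (\<forall>j. real_of_int (z $ j) = (\<Sum>v\<in>V. r v * real_of_int (homog v $ j))) \<longrightarrow>
      real_of_int (\<Sum>j\<in>UNIV. c $ j * z $ j) = r w" if w: "w \<in> V" for w
  proof -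
    obtain c where c: "\<And>v. v \<in> V \<Longrightarrow> (\<Sum>j\<in>UNIV. c $ j * homog v $ j) = (if v = w then 1 else 0)"
      using dual[OF w] by blast
    have "real_of_int (\<Sum>j\<in>UNIV. c $ j * z $ j) = r w"
      if "\<forall>j. real_of_int (z $ j) = (\<Sum>v\<in>V. r v * real_of_int (homog v $ j))" for r z
    proof -
      have "real_of_int (\<Sum>j\<in>UNIV. c $ j * z $ j)
          = (\<Sum>j\<in>UNIV. \<Sum>v\<in>V. r v * real_of_int (c $ j * homog v $ j))"
        using that by (simp add: sum_distrib_left mult_ac)
      also have "\<dots> = (\<Sum>v\<in>V. r v * real_of_int (\<Sum>j\<in>UNIV. c $ j * homog v $ j))"
        by (subst sum.swap) (simp add: sum_distrib_left)
      also have "\<dots> = (\<Sum>v\<in>V. r v * (if v = w then 1 else 0))"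
        by (intro sum.cong) (auto simp: c)
      also have "\<dots> = r w" using w assms(1) by (simp add: if_distrib cong: if_cong)
      finally show ?thesis .
    qed
    then show ?thesis by blast
  qed
  have inj: "inj_on ?h (bounded_weight den V N - {\<lambda>_. 0})"
  proof (rule inj_onI)
    fix a b assume ab: "a \<in> bounded_weight den V N - {\<lambda>_. 0}" "b \<in> bounded_weight den V N - {\<lambda>_. 0}"
      and eq: "?h a = ?h b"
    have "a w = b w" if w: "w \<in> V" for w
    proof -
      obtain c :: "int ^ 'n option" where c: "\<And>r z. (\<forall>j. real_of_int (z $ j) =
          (\<Sum>v\<in>V. r v * real_of_int (homog v $ j))) \<Longrightarrow> real_of_int (\<Sum>j\<in>UNIV. c $ j * z $ j) = r w"
        using coord[OF w] by blast
      have "real (f w) = real_of_int (\<Sum>j\<in>UNIV. c $ j * ?h f $ j)" for f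
        by (rule c[of "?h f" "\<lambda>v. real (f v)", symmetric]) simp
      from this[of a] this[of b] show ?thesis unfolding eq by simp
    qed
    then show "a = b" using ab by (auto simp: bounded_weight_def fun_eq_iff) metis
  qed
  have into: "?h a \<in> cone_points N (convex hull V)" if a: "a \<in> bounded_weight den V N - {\<lambda>_. 0}" for a
  proof -
    let ?k = "\<Sum>v\<in>V. a v * den v"
    obtain w where w: "a w \<noteq> 0" using a by (auto simp: fun_eq_iff)
    then have "w \<in> V" using a by (auto simp: bounded_weight_def)
    then have k: "?k > 0"
      using w den_pos[of w] assms(1) by (intro sum_pos2[of V w]) auto
    have None: "?h a $ None = int ?k"
      unfolding nth by (simp add: of_int_homog(2) rat)
    \<comment> \<open>The barycentric weight of \<open>v\<close> is its share of the total
      height.\<close>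
    define u where "u v = real (a v * den v) / real ?k" for v
    have "(\<chi> j. real_of_int (?h a $ Some j) / real_of_int (?h a $ None)) = (\<Sum>v\<in>V. u v *\<^sub>R v)"
      unfolding None unfolding nth
      by (simp add: vec_eq_iff of_int_homog(1) rat u_def sum_divide_distrib mult_ac)
    moreover have "(\<Sum>v\<in>V. u v) = 1"
      using k unfolding u_def sum_divide_distrib[symmetric] of_nat_sum[symmetric]
      by (simp del: of_nat_sum)
    moreover have "\<forall>v\<in>V. 0 \<le> u v"
      by (simp add: u_def del: of_nat_sum)
    ultimately have "(\<chi> j. real_of_int (?h a $ Some j) / real_of_int (?h a $ None)) \<in> convex hull V"
      unfolding convex_hull_finite[OF assms(1)] mem_Collect_eq by (intro exI[of _ u] conjI) simp_all
    moreover have "?k \<le> N" using a by (simp add: bounded_weight_def)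
    then have "0 < ?h a $ None" "?h a $ None \<le> int N"
      unfolding None using k by (simp_all del: of_nat_sum)
    ultimately show ?thesis unfolding cone_points_def mem_Collect_eq by blast
  qed
  have onto: "z \<in> ?h ` (bounded_weight den V N - {\<lambda>_. 0})" if z: "z \<in> cone_points N (convex hull V)" for z
  proof -
    have z0: "0 < z $ None" "z $ None \<le> int N"
      and "(\<chi> j. real_of_int (z $ Some j) / real_of_int (z $ None)) \<in> convex hull V"
      using z by (auto simp: cone_points_def)
    then obtain u where u: "\<And>v. v \<in> V \<Longrightarrow> 0 \<le> u v" "sum u V = 1"
      "(\<Sum>v\<in>V. u v *\<^sub>R v) = (\<chi> j. real_of_int (z $ Some j) / real_of_int (z $ None))"
      unfolding convex_hull_finite[OF assms(1)] mem_Collect_eq by blast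
    \<comment> \<open>The inverse of the passage from coefficients to barycentric weights.\<close>
    define r where "r v = real_of_int (z $ None) * u v / real (den v)" for v
    have rd: "r v * real (den v) = real_of_int (z $ None) * u v" if "v \<in> V" for v
      using den_pos[OF that] by (simp add: r_def)
    have zr: "real_of_int (z $ j) = (\<Sum>v\<in>V. r v * real_of_int (homog v $ j))" for j
    proof (cases j)
      case None
      have "(\<Sum>v\<in>V. r v * real_of_int (homog v $ j)) = (\<Sum>v\<in>V. real_of_int (z $ None) * u v)"
        using None by (intro sum.cong) (auto simp: of_int_homog(2) rat rd)
      then show ?thesis using u(2) None by (simp add: sum_distrib_left[symmetric])
    next
      case (Some k)
      have "(\<Sum>v\<in>V. r v * real_of_int (homog v $ j)) = (\<Sum>v\<in>V. real_of_int (z $ None) * u v * v $ k)"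
        using Some by (intro sum.cong) (auto simp: of_int_homog(1) rat rd[symmetric])
      also have "\<dots> = real_of_int (z $ None) * (\<Sum>v\<in>V. u v *\<^sub>R v) $ k"
        by (simp add: sum_distrib_left mult_ac)
      also have "\<dots> = real_of_int (z $ j)" unfolding u(3) using z0 Some by simp
      finally show ?thesis by simp
    qed
    have "\<exists>m::nat. r w = real m" if w: "w \<in> V" for w
    proof -
      obtain c :: "int ^ 'n option" where c: "\<And>r z. (\<forall>j. real_of_int (z $ j) =
          (\<Sum>v\<in>V. r v * real_of_int (homog v $ j))) \<Longrightarrow> real_of_int (\<Sum>j\<in>UNIV. c $ j * z $ j) = r w"
        using coord[OF w] by blast
      have "real_of_int (\<Sum>j\<in>UNIV. c $ j * z $ j) = r w"
        using c zr by blast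
      moreover have "r w \<ge> 0" using u(1)[OF w] z0 by (simp add: r_def)
      ultimately show ?thesis by (metis of_int_0_le_iff of_int_of_nat_eq zero_le_imp_eq_int)
    qed
    then obtain a' where a': "\<And>w. w \<in> V \<Longrightarrow> r w = real (a' w)" by metis
    define a where "a w = (if w \<in> V then a' w else 0)" for w
    have "real_of_int (z $ j) = real_of_int (?h a $ j)" for j
      unfolding nth zr by (simp add: a_def a')
    then have za: "z = ?h a" unfolding of_int_eq_iff vec_eq_iff by blast
    have height: "z $ None = int (\<Sum>v\<in>V. a v * den v)"
      unfolding za nth by (simp add: of_int_homog(2) rat)
    have "0 < (\<Sum>v\<in>V. a v * den v)" "(\<Sum>v\<in>V. a v * den v) \<le> N"
      using z0 unfolding height by (simp_all only: of_nat_0_less_iff of_nat_le_iff)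
    moreover have "\<forall>x. x \<notin> V \<longrightarrow> a x = 0" by (simp add: a_def)
    ultimately have "a \<in> bounded_weight den V N" "a \<noteq> (\<lambda>_. 0)"
      unfolding bounded_weight_def by auto
    then show ?thesis using za by blast
  qed
  show ?thesis
  proof (rule bij_betw_imageI[OF inj])
    show "?h ` (bounded_weight den V N - {\<lambda>_. 0}) = cone_points N (convex hull V)"
      using into onto by blast
  qed
qed

text \<open>Transfers the count from an affinely independent set to the vertices of its hull. The
  empty simplex is included, with no vertices and \<open>aff_dim\<close> equal to -1.\<close>

lemma regular_simplex_cone_points:
  fixes T :: "(real ^ 'n) set"
  assumes "regular_simplex T"
  shows "finite (vertices T)" and "int (card (vertices T)) = aff_dim T + 1"
    and "den_simplex T > 0"
    and "bij_betw (\<lambda>a. \<Sum>v\<in>vertices T. int (a v) *s homog v)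
      (bounded_weight den (vertices T) N - {\<lambda>_. 0}) (cone_points N T)"
    and "finite (bounded_weight den (vertices T) N)"
proof -
  obtain m where m: "m simplex T" and rat: "\<And>v. v \<in> vertices T \<Longrightarrow> rational_point v"
    and basis: "part_of_int_basis (homog ` vertices T)"
    using assms by (auto simp: regular_simplex_def rational_simplex_def)
  then obtain V where V: "finite V" "\<not> affine_dependent V" "int (card V) = m + 1" "T = convex hull V"
    unfolding simplex by blast
  then have vert: "vertices T = V" by (simp add: vertices_convex_hull)
  show "finite (vertices T)" "int (card (vertices T)) = aff_dim T + 1"
    using V aff_dim_simplex[OF m] vert by auto
  show "den_simplex T > 0"
    using rat by (auto simp: den_simplex_def den_rational_point(1) intro!: prod_pos)
  show "bij_betw (\<lambda>a. \<Sum>v\<in>vertices T. int (a v) *s homog v)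
      (bounded_weight den (vertices T) N - {\<lambda>_. 0}) (cone_points N T)"
    using bij_betw_cone_points[of V N] V(1,4) rat basis vert by simp
  show "finite (bounded_weight den (vertices T) N)"
    using rat V(1) vert by (auto intro!: finite_bounded_weight den_rational_point(1))
qed

section \<open>Finiteness and growth of the counts\<close>

lemma finite_cone_points:
  assumes "regular_simplex T"
  shows "finite (cone_points N T)"
  using bij_betw_finite[OF regular_simplex_cone_points(4)[OF assms, of N]]
    regular_simplex_cone_points(5)[OF assms, of N] by simp

text \<open>The cone has dimension \<open>Suc i\<close>, which explains both the exponent and the
  factorial. Both polynomial bounds have the same leading coefficient, so the limit follows by
  sandwiching.\<close>

lemma cone_points_asymptotics:
  fixes T :: "(real ^ 'n) set"
  assumes "regular_simplex T" "aff_dim T = int i"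
  shows "(\<lambda>N. real (card (cone_points N T)) / real N ^ Suc i)
    \<longlonglongrightarrow> 1 / (fact (Suc i) * real (den_simplex T))"
proof -
  let ?V = "vertices T"
  define E where "E = fact (Suc i) * real (den_simplex T)"
  define s where "s = real (\<Sum>v\<in>?V. den v)"
  note T = regular_simplex_cone_points[OF assms(1)]
  have E: "E > 0" using T(3) by (simp add: E_def)
  have cV: "card ?V = Suc i" using T(2) assms(2) by simp
  have pos: "den v > 0" if "v \<in> ?V" for v
    using assms(1) that by (auto simp: regular_simplex_def rational_simplex_def den_rational_point(1))
  \<comment> \<open>The subtracted 1 accounts for the zero coefficient vector.\<close>
  have C: "real (card (cone_points N T)) = real (card (bounded_weight den ?V N)) - 1" for N
  proof -
    have z: "(\<lambda>_. 0) \<in> bounded_weight den ?V N" by (simp add: bounded_weight_def)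
    then have "card (bounded_weight den ?V N) > 0" using T(5)[of N] by (auto simp: card_gt_0_iff)
    then show ?thesis
      using bij_betw_same_card[OF T(4)[of N]] z T(5)[of N] by (simp add: card_Diff_singleton)
  qed
  have bounds: "real N ^ Suc i / E \<le> real (card (bounded_weight den ?V N))"
    "real (card (bounded_weight den ?V N)) \<le> (real N + s) ^ Suc i / E" for N
    using card_bounded_weight_bounds[where d = den and N = N, OF T(1) pos] cV
    by (auto simp: E_def s_def den_simplex_def)
  have lim: "(\<lambda>N. inverse (real N)) \<longlonglongrightarrow> 0" by (rule LIMSEQ_inverse_real_of_nat[THEN LIMSEQ_imp_Suc])
  have "(\<lambda>N. 1 / E - inverse (real N) ^ Suc i) \<longlonglongrightarrow> 1 / E - 0 ^ Suc i"
    by (intro tendsto_intros lim)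
  then have lower: "(\<lambda>N. 1 / E - inverse (real N) ^ Suc i) \<longlonglongrightarrow> 1 / E"
    by (simp only: power_0_Suc diff_zero)
  have "(\<lambda>N. (1 + s * inverse (real N)) ^ Suc i / E) \<longlonglongrightarrow> (1 + s * 0) ^ Suc i / E"
    using E by (intro tendsto_intros lim) auto
  then have upper: "(\<lambda>N. (1 + s * inverse (real N)) ^ Suc i / E) \<longlonglongrightarrow> 1 / E"
    by (simp only: mult_zero_right add_0_right power_one)
  have "\<forall>\<^sub>F N in sequentially.
      1 / E - inverse (real N) ^ Suc i \<le> real (card (cone_points N T)) / real N ^ Suc i"
    using eventually_gt_at_top[of 0]
  proof eventually_elim
    case (elim N)
    have "1 / E - inverse (real N) ^ Suc i = (real N ^ Suc i / E - 1) / real N ^ Suc i"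
      using elim E by (simp add: field_simps)
    also have "\<dots> \<le> real (card (cone_points N T)) / real N ^ Suc i"
      unfolding C using bounds(1)[of N] by (intro divide_right_mono) auto
    finally show ?case .
  qed
  moreover have "\<forall>\<^sub>F N in sequentially.
      real (card (cone_points N T)) / real N ^ Suc i \<le> (1 + s * inverse (real N)) ^ Suc i / E"
    using eventually_gt_at_top[of 0]
  proof eventually_elim
    case (elim N)
    have "real (card (cone_points N T)) / real N ^ Suc i
        \<le> ((real N + s) ^ Suc i / E) / real N ^ Suc i"
      unfolding C using bounds(2)[of N] by (intro divide_right_mono) auto
    also have "\<dots> = ((real N + s) / real N) ^ Suc i / E"
      by (simp only: power_divide) (simp add: mult.commute)
    also have "(real N + s) / real N = 1 + s * inverse (real N)"
      using elim by (simp add: field_simps)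
    finally show ?case .
  qed
  ultimately show ?thesis
    unfolding E_def[symmetric] by (rule tendsto_sandwich[OF _ _ lower upper])
qed

text \<open>In dimension \<open>j < i\<close> the count has order \<open>N ^ Suc j\<close>, leaving
  a factor \<open>inverse N ^ (i - j)\<close> that tends to 0. The empty face, whose dimension is
  not a natural number, is treated separately.\<close>

lemma cone_points_negligible:
  fixes T :: "(real ^ 'n) set"
  assumes "regular_simplex T" "aff_dim T < int i"
  shows "(\<lambda>N. real (card (cone_points N T)) / real N ^ Suc i) \<longlonglongrightarrow> 0"
proof (cases "T = {}")
  case True
  then show ?thesis by simp
next
  case False
  then obtain j where j: "aff_dim T = int j"
    by (metis aff_dim_empty aff_dim_negative_iff linorder_not_less zero_le_imp_eq_int)
  then have ij: "j < i" using assms(2) by simp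
  have "(\<lambda>N. inverse (real N)) \<longlonglongrightarrow> 0" by (rule LIMSEQ_inverse_real_of_nat[THEN LIMSEQ_imp_Suc])
  then have "(\<lambda>N. real (card (cone_points N T)) / real N ^ Suc j * inverse (real N) ^ (i - j))
      \<longlonglongrightarrow> 1 / (fact (Suc j) * real (den_simplex T)) * 0 ^ (i - j)"
    by (intro tendsto_mult cone_points_asymptotics assms j tendsto_power)
  moreover have "real (card (cone_points N T)) / real N ^ Suc j * inverse (real N) ^ (i - j)
      = real (card (cone_points N T)) / real N ^ Suc i" for N
  proof -
    have "real N ^ Suc i = real N ^ Suc j * real N ^ (i - j)"
      using ij by (simp only: power_add[symmetric]) simp
    then show ?thesis by (simp only: divide_inverse power_inverse inverse_mult_distrib mult.assoc)
  qed
  moreover have "1 / (fact (Suc j) * real (den_simplex T)) * 0 ^ (i - j) = 0"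
    using ij by simp
  ultimately show ?thesis by (simp only:)
qed

section \<open>Comparing two triangulations\<close>

text \<open>The common face \<open>T \<inter> S\<close> meets the relative interior of
  \<open>T\<close>, so it is all of \<open>T\<close>; maximality does the rest.\<close>

lemma max_simplexes_rel_interior_unique:
  assumes "simplicial_complex \<Delta>" "T \<in> max_simplexes \<Delta> i" "S \<in> \<Delta>" "x \<in> rel_interior T" "x \<in> S"
  shows "S = T"
proof -
  have T: "T \<in> \<Delta>" "\<And>S. S \<in> \<Delta> \<Longrightarrow> T \<subseteq> S \<Longrightarrow> S = T"
    using assms(2) by (auto simp: max_simplexes_def)
  have "T \<inter> S face_of T"
    using assms(1,3) T(1) by (auto simp: simplicial_complex_def)
  moreover have "T \<inter> S \<inter> rel_interior T \<noteq> {}"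
    using assms(4,5) rel_interior_subset by blast
  ultimately have "T \<subseteq> T \<inter> S"
    using subset_of_face_of by blast
  then show ?thesis using T(2) assms(3) by blast
qed

lemma max_simplexes_rel_interior_covered:
  fixes \<Delta> \<Delta>' :: "(real ^ 'n) set set"
  assumes "simplicial_complex \<Delta>" "simplicial_complex \<Delta>'" "\<Union>\<Delta>' = \<Union>\<Delta>"
    and T: "T \<in> max_simplexes \<Delta> i" and x: "x \<in> rel_interior T"
  shows "\<exists>S \<in> \<Delta>'. x \<in> S \<and> (aff_dim S < int i \<or> S \<in> max_simplexes \<Delta>' i)"
proof -
  have T': "T \<in> \<Delta>" "int i simplex T" using T by (auto simp: max_simplexes_def)
  have fin: "finite \<Delta>" using assms(1) by (simp add: simplicial_complex_def)
  \<comment> \<open>An open neighbourhood of \<open>x\<close> in which the polyhedron has no points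
    outside \<open>T\<close>.\<close>
  define U where "U = - \<Union>(\<Delta> - {T})"
  have "closed (\<Union>(\<Delta> - {T}))"
    using assms(1) fin
    by (intro closed_Union) (auto simp: simplicial_complex_def intro: closed_simplex)
  then have U: "open U" by (simp add: U_def open_closed)
  have xU: "x \<in> U"
    using max_simplexes_rel_interior_unique[OF assms(1) T _ x] by (auto simp: U_def)
  have UT: "S \<inter> U \<subseteq> T" if "S \<in> \<Delta>'" for S
    using that assms(3) by (auto simp: U_def)
  have conv: "convex S" if "S \<in> \<Delta>'" for S
    using that assms(2) unfolding simplicial_complex_def by (metis convex_simplex)
  \<comment> \<open>Intersecting a convex set with an open set that meets it preserves its
    dimension, and near \<open>x\<close> everything lies in \<open>T\<close>.\<close>
  have dim: "aff_dim S \<le> int i" if S: "S \<in> \<Delta>'" "x \<in> S" for S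
  proof -
    have "S \<inter> U \<noteq> {}" using S(2) xU by blast
    then have "aff_dim S = aff_dim (S \<inter> U)"
      using aff_dim_convex_Int_open[OF conv[OF S(1)] U] by simp
    also have "\<dots> \<le> aff_dim T" using UT[OF S(1)] by (rule aff_dim_subset)
    finally show ?thesis using aff_dim_simplex[OF T'(2)] by simp
  qed
  have "x \<in> \<Union>\<Delta>'" using x rel_interior_subset T'(1) assms(3) by blast
  then obtain S where S: "S \<in> \<Delta>'" "x \<in> S" by blast
  obtain m where m: "m simplex S" using S assms(2) by (auto simp: simplicial_complex_def)
  have "S \<in> max_simplexes \<Delta>' i" if "\<not> aff_dim S < int i"
  proof -
    have Si: "aff_dim S = int i" using that dim[OF S] by simp
    \<comment> \<open>A strictly larger \<open>S'\<close> would have \<open>S\<close> as a proper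
      face, hence dimension above \<open>i\<close>; but \<open>S'\<close> contains \<open>x\<close>,
      so \<open>dim\<close> applies to it.\<close>
    have "S' = S" if S': "S' \<in> \<Delta>'" "S \<subseteq> S'" for S'
    proof (rule ccontr)
      assume ne: "S' \<noteq> S"
      have "S' \<inter> S face_of S'"
        using S' S assms(2) by (auto simp: simplicial_complex_def)
      then have "S face_of S'" using S'(2) by (simp add: Int_absorb1)
      then have "aff_dim S < aff_dim S'" using ne face_of_aff_dim_lt[OF conv[OF S'(1)]] by blast
      then show False using dim[of S'] S' S Si by auto
    qed
    then show ?thesis
      using S m Si aff_dim_simplex[OF m] by (auto simp: max_simplexes_def)
  qed
  then show ?thesis using S by blast
qed

lemma lambda_sum_le:
  fixes \<Delta> \<Delta>' :: "(real ^ 'n) set set"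
  assumes "regular_triangulation \<Delta> P" "regular_triangulation \<Delta>' P"
  shows "lambda_sum i \<Delta> \<le> lambda_sum i \<Delta>'"
proof -
  let ?M = "max_simplexes \<Delta> i" and ?M' = "max_simplexes \<Delta>' i"
  let ?C = "\<lambda>N S. card (cone_points N S)"
  \<comment> \<open>Both complexes contribute: faces from \<open>\<Delta>\<close> cover the
    boundaries of its maximal simplexes, and those from \<open>\<Delta>'\<close> cover interior
    points missed by \<open>?M'\<close>.\<close>
  define L where "L = {S \<in> \<Delta> \<union> \<Delta>'. aff_dim S < int i}"
  have cx: "simplicial_complex \<Delta>" "simplicial_complex \<Delta>'" "\<Union>\<Delta>' = \<Union>\<Delta>"
    and reg: "\<And>T. T \<in> \<Delta> \<union> \<Delta>' \<Longrightarrow> regular_simplex T"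
    using assms by (auto simp: regular_triangulation_def)
  have fin: "finite \<Delta>" "finite \<Delta>'" using cx by (auto simp: simplicial_complex_def)
  have subs: "?M \<subseteq> \<Delta>" "?M' \<subseteq> \<Delta>'" "L \<subseteq> \<Delta> \<union> \<Delta>'"
    by (auto simp: max_simplexes_def L_def)
  have finM: "finite ?M" "finite ?M'" "finite L"
    using subs fin by (auto intro: finite_subset)
  have finC: "finite (cone_points N T)" if "T \<in> \<Delta> \<union> \<Delta>'" for N T
    using finite_cone_points reg that by blast
  have CL: "card (cone_points N (\<Union>S\<in>L. S)) \<le> (\<Sum>S\<in>L. ?C N S)"
    and finL: "finite (cone_points N (\<Union>S\<in>L. S))" for N
    unfolding cone_points_UN using finM subs finC by (auto intro!: card_UN_le)
  have finr: "finite (cone_points N (rel_interior T))" if "T \<in> ?M" for N T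
    using finC that subs cone_points_mono[OF rel_interior_subset] by (meson UnI1 finite_subset subsetD)
  \<comment> \<open>The relative boundary is the union of the facets, which belong to
    \<open>\<Delta>\<close> by closure under faces and have dimension below
    \<open>i\<close>.\<close>
  have interior: "?C N T \<le> ?C N (rel_interior T) + (\<Sum>S\<in>L. ?C N S)" if T: "T \<in> ?M" for N T
  proof -
    have T': "T \<in> \<Delta>" "int i simplex T" using T by (auto simp: max_simplexes_def)
    have "T - rel_interior T \<subseteq> (\<Union>S\<in>L. S)"
    proof
      fix x assume "x \<in> T - rel_interior T"
      then obtain F where F: "F facet_of T" "x \<in> F"
        using rel_boundary_of_polyhedron[OF simplex_imp_polyhedron[OF T'(2)]] by blast
      then have "F \<in> \<Delta>" "aff_dim F < int i"
        using cx(1) T' aff_dim_simplex[OF T'(2)] by (auto simp: simplicial_complex_def facet_of_def)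
      then show "x \<in> (\<Union>S\<in>L. S)" using F by (auto simp: L_def)
    qed
    then have "cone_points N T \<subseteq> cone_points N (rel_interior T \<union> (\<Union>S\<in>L. S))"
      by (intro cone_points_mono) auto
    then have "?C N T \<le> card (cone_points N (rel_interior T) \<union> cone_points N (\<Union>S\<in>L. S))"
      unfolding cone_points_Un using finr[OF T] finL by (intro card_mono) auto
    also have "\<dots> \<le> ?C N (rel_interior T) + ?C N (\<Union>S\<in>L. S)" by (rule card_Un_le)
    finally show ?thesis using CL[of N] by simp
  qed
  \<comment> \<open>The error from \<open>L\<close> occurs once for the boundary of each member of
    \<open>?M\<close>, and once more when the interiors are covered by \<open>\<Delta>'\<close>. The
    interiors are disjoint, so their counts add up exactly.\<close>
  have "(\<Sum>T\<in>?M. ?C N T) \<le> (\<Sum>T\<in>?M'. ?C N T) + Suc (card ?M) * (\<Sum>S\<in>L. ?C N S)" for N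
  proof -
    have disj: "cone_points N (rel_interior S) \<inter> cone_points N (rel_interior T) = {}"
      if "S \<in> ?M" "T \<in> ?M" "S \<noteq> T" for S T
    proof -
      have "rel_interior S \<inter> rel_interior T = {}"
        using max_simplexes_rel_interior_unique[OF cx(1), of T i S] that subs rel_interior_subset
        by blast
      then show ?thesis by (simp add: cone_points_Int[symmetric])
    qed
    have "(\<Sum>T\<in>?M. ?C N T) \<le> (\<Sum>T\<in>?M. ?C N (rel_interior T) + (\<Sum>S\<in>L. ?C N S))"
      by (intro sum_mono interior)
    also have "\<dots> = (\<Sum>T\<in>?M. ?C N (rel_interior T)) + card ?M * (\<Sum>S\<in>L. ?C N S)"
      by (simp add: sum.distrib)
    also have "(\<Sum>T\<in>?M. ?C N (rel_interior T)) = card (\<Union>T\<in>?M. cone_points N (rel_interior T))"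
      using finM(1) finr disj by (intro card_UN_disjoint[symmetric]) auto
    also have "\<dots> \<le> card ((\<Union>T\<in>?M'. cone_points N T) \<union> cone_points N (\<Union>S\<in>L. S))"
    proof (rule card_mono)
      have "(\<Union>T\<in>?M. rel_interior T) \<subseteq> (\<Union>T\<in>?M'. T) \<union> (\<Union>S\<in>L. S)"
      proof
        fix x assume "x \<in> (\<Union>T\<in>?M. rel_interior T)"
        then obtain S where "S \<in> \<Delta>'" "x \<in> S" "aff_dim S < int i \<or> S \<in> ?M'"
          using max_simplexes_rel_interior_covered[OF cx] by blast
        then show "x \<in> (\<Union>T\<in>?M'. T) \<union> (\<Union>S\<in>L. S)" unfolding L_def by blast
      qed
      from cone_points_mono[OF this, of N]
      show "(\<Union>T\<in>?M. cone_points N (rel_interior T))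
          \<subseteq> (\<Union>T\<in>?M'. cone_points N T) \<union> cone_points N (\<Union>S\<in>L. S)"
        by (simp only: cone_points_Un cone_points_UN)
      show "finite ((\<Union>T\<in>?M'. cone_points N T) \<union> cone_points N (\<Union>S\<in>L. S))"
        using finM(2) finL finC subs(2) by blast
    qed
    also have "\<dots> \<le> (\<Sum>T\<in>?M'. ?C N T) + (\<Sum>S\<in>L. ?C N S)"
      using card_Un_le[of "\<Union>T\<in>?M'. cone_points N T" "cone_points N (\<Union>S\<in>L. S)"]
        card_UN_le[OF finM(2), of "cone_points N"] CL[of N] by linarith
    finally show ?thesis by simp
  qed
  then have "(\<Sum>T\<in>?M. real (?C N T))
      \<le> (\<Sum>T\<in>?M'. real (?C N T)) + real (Suc (card ?M)) * (\<Sum>S\<in>L. real (?C N S))" for N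
    by (simp only: of_nat_sum[symmetric] of_nat_mult[symmetric] of_nat_add[symmetric] of_nat_le_iff)
  then have le: "(\<Sum>T\<in>?M. real (?C N T) / real N ^ Suc i) \<le> (\<Sum>T\<in>?M'. real (?C N T) / real N ^ Suc i)
      + real (Suc (card ?M)) * (\<Sum>S\<in>L. real (?C N S) / real N ^ Suc i)" for N
    unfolding sum_divide_distrib[symmetric] times_divide_eq_right add_divide_distrib[symmetric]
    by (intro divide_right_mono) auto
  have lim: "(\<lambda>N. real (?C N T) / real N ^ Suc i) \<longlonglongrightarrow> 1 / (fact (Suc i) * real (den_simplex T))"
    if "T \<in> ?M \<union> ?M'" for T
    using that reg by (intro cone_points_asymptotics) (auto simp: max_simplexes_def aff_dim_simplex)
  have "(\<lambda>N. real (?C N S) / real N ^ Suc i) \<longlonglongrightarrow> 0" if "S \<in> L" for S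
    using that reg by (intro cone_points_negligible) (auto simp: L_def)
  then have "(\<lambda>N. (\<Sum>T\<in>?M'. real (?C N T) / real N ^ Suc i)
      + real (Suc (card ?M)) * (\<Sum>S\<in>L. real (?C N S) / real N ^ Suc i)) \<longlonglongrightarrow>
      (\<Sum>T\<in>?M'. 1 / (fact (Suc i) * real (den_simplex T))) + real (Suc (card ?M)) * (\<Sum>S\<in>L. 0)"
    by (intro tendsto_add tendsto_mult tendsto_sum tendsto_const lim) auto
  moreover have "(\<lambda>N. \<Sum>T\<in>?M. real (?C N T) / real N ^ Suc i)
      \<longlonglongrightarrow> (\<Sum>T\<in>?M. 1 / (fact (Suc i) * real (den_simplex T)))"
    by (intro tendsto_sum lim) auto
  ultimately have "(\<Sum>T\<in>?M. 1 / (fact (Suc i) * real (den_simplex T)))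
      \<le> (\<Sum>T\<in>?M'. 1 / (fact (Suc i) * real (den_simplex T))) + real (Suc (card ?M)) * (\<Sum>S\<in>L. 0)"
    using le by (intro LIMSEQ_le) auto
  \<comment> \<open>The cone counts carry \<open>fact (Suc i)\<close> where
    \<open>lambda_sum\<close> has \<open>fact i\<close>; the common positive factor
    \<open>Suc i\<close> cancels.\<close>
  moreover have "(\<Sum>T\<in>A. 1 / (fact (Suc i) * real (den_simplex T)))
      = (\<Sum>T\<in>A. 1 / (fact i * real (den_simplex T))) / real (Suc i)" for A :: "(real ^ 'n) set set"
    by (simp add: sum_divide_distrib mult_ac)
  ultimately show ?thesis
    unfolding lambda_sum_def by (simp add: divide_le_cancel del: of_nat_Suc)
qed

theorem proposition4p1:
  fixes P :: "(real ^ 'n) set" and \<Delta> \<Delta>' :: "(real ^ 'n) set set" and i :: nat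
  assumes "rational_polyhedron P"
    and "regular_triangulation \<Delta> P"
    and "regular_triangulation \<Delta>' P"
  shows "lambda_sum i \<Delta> = lambda_sum i \<Delta>'"
  using lambda_sum_le[OF assms(2,3)] lambda_sum_le[OF assms(3,2)] by (rule antisym)

end
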